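(* There is an absolute constant $C>0$ such that for every integer $r\ge 2$, $$n_0(r)\ \le\ 2r+2\log_2 r + C\log_2\log_2 r ,$$ that is, $n_0(r)\le 2r+2\log_2 r+O(\log_2\log_2 r)$.
   Context: For a positive integer $n$ write $[n]=\{1,\dots,n\}$. For a family $\mathcal F\subseteq 2^{[n]}$ write $S(\mathcal F)=\{|A| : A\in\mathcal F\}$ and $\mathcal F_t=\{A\in\mathcal F : |A|=t\}$ for $t=0,1,\dots,n$. Given an integer $r\ge 1$, $\mathcal F$ is called an $r$-multiplicity antichain if (i) $A\not\subseteq B$ for all distinct $A,B\in\mathcal F$, and (ii) $|\mathcal F_t|\ge r$ for every $t\in S(\mathcal F)$. For integers $n,r\ge 1$ define $$g(n,r)=\max\{|S(\mathcal F)| : \mathcal F\subseteq 2^{[n]} \text{ is an } r\text{-multiplicity antichain}\}.$$ For an integer $r\ge 2$, $n_0(r)$ denotes the smallest integer $n_0$ such that $g(n,r)=n-3$ for every integer $n>n_0$. *)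

theory Defs
  imports Complex_Main
begin

definition sizes :: "nat set set \<Rightarrow> nat set" where
  "sizes \<F> = {card A | A. A \<in> \<F>}"

definition layer :: "nat set set \<Rightarrow> nat \<Rightarrow> nat set set" where
  "layer \<F> t = {A \<in> \<F>. card A = t}"

definition multiplicity_antichain :: "nat \<Rightarrow> nat set set \<Rightarrow> bool" where
  "multiplicity_antichain r \<F> \<longleftrightarrow>
     (\<forall>A\<in>\<F>. \<forall>B\<in>\<F>. A \<noteq> B \<longrightarrow> \<not> A \<subseteq> B) \<and>
     (\<forall>t\<in>sizes \<F>. r \<le> card (layer \<F> t))"

definition g :: "nat \<Rightarrow> nat \<Rightarrow> nat" where
  "g n r = Max {card (sizes \<F>) | \<F>. \<F> \<subseteq> Pow {1..n} \<and> multiplicity_antichain r \<F>}"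

text \<open>
  The subtraction \<open>n - 3\<close> is taken in the integers. The threshold may range over the natural
  numbers: no negative threshold qualifies, because \<open>n - 3 < 0\<close> at \<open>n = 1\<close>.
\<close>

definition n0 :: "nat \<Rightarrow> nat" where
  "n0 r = (LEAST m. \<forall>n>m. int (g n r) = int n - 3)"

end

theory Submission
  imports Defs
begin

text \<open>
  Since \<open>r \<ge> 2\<close>, two sets of size \<open>1\<close> exclude the sizes \<open>n - 2\<close> and \<open>n - 1\<close>, and dually, so at
  most \<open>n - 3\<close> sizes occur. To realise all sizes from \<open>2\<close> to \<open>n - 2\<close>, it suffices to realise the
  sizes up to \<open>n div 2\<close> by sets through one common point \<open>v\<close> and to add complements: a set
  through \<open>v\<close> is never contained in the complement of a set through \<open>v\<close>. The layer of size \<open>2\<close> is a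
  star with \<open>r\<close> leaves at \<open>v\<close>. The layer of size \<open>j + 1\<close> consists of the sets
  \<open>{v} \<union> D j \<union> X\<close>, where \<open>X\<close> varies in a set \<open>Q\<close> of at least \<open>r\<close> further points and the codes \<open>D j\<close>
  satisfy \<open>\<not> D i \<subseteq> D j\<close> for \<open>i < j\<close>. All subsets of \<open>t\<close> points yield \<open>2 ^ t\<close> codes, hence the
  \<open>log 2 r\<close>; the condition \<open>card (D j) < j\<close> for small \<open>j\<close> costs \<open>O(log 2 (log 2 r))\<close> more points.
  For \<open>r = 2\<close>, where the error term vanishes, an induction from \<open>n\<close> to \<open>n + 2\<close> is used instead.
\<close>

section \<open>The upper bound\<close>

lemma finite_sizes_values:
  "finite {card (sizes \<F>) | \<F>. \<F> \<subseteq> Pow {1..n} \<and> multiplicity_antichain r \<F>}"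
proof -
  have "{card (sizes \<F>) | \<F>. \<F> \<subseteq> Pow {1..n} \<and> multiplicity_antichain r \<F>}
      \<subseteq> (\<lambda>\<F>. card (sizes \<F>)) ` Pow (Pow {1..n})"
    by blast
  then show ?thesis
    by (rule finite_subset) simp
qed

lemma g_le:
  assumes "\<And>\<F>. \<F> \<subseteq> Pow {1..n} \<Longrightarrow> multiplicity_antichain r \<F> \<Longrightarrow> card (sizes \<F>) \<le> k"
  shows "g n r \<le> k"
proof -
  have "multiplicity_antichain r {}"
    by (auto simp: multiplicity_antichain_def sizes_def)
  then have "{card (sizes \<F>) | \<F>. \<F> \<subseteq> Pow {1..n} \<and> multiplicity_antichain r \<F>} \<noteq> {}"
    by blast
  then show ?thesis
    unfolding g_def using assms by (subst Max_le_iff[OF finite_sizes_values]) auto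
qed

lemma g_ge:
  assumes "\<F> \<subseteq> Pow {1..n}" "multiplicity_antichain r \<F>"
  shows "card (sizes \<F>) \<le> g n r"
  unfolding g_def using assms by (intro Max_ge[OF finite_sizes_values]) blast

lemma two_in_layer:
  assumes "multiplicity_antichain r \<F>" "2 \<le> r" "s \<in> sizes \<F>"
  obtains A B where "A \<in> \<F>" "B \<in> \<F>" "A \<noteq> B" "card A = s" "card B = s"
proof -
  have "2 \<le> card (layer \<F> s)"
    using assms unfolding multiplicity_antichain_def by fastforce
  then obtain T where "T \<subseteq> layer \<F> s" "card T = 2"
    by (meson obtain_subset_with_card_n)
  then obtain A B where "{A, B} \<subseteq> layer \<F> s" "A \<noteq> B"
    by (metis card_2_iff)
  then show ?thesis
    using that by (auto simp: layer_def)
qed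

text \<open>Sizes 0 and n admit a single set each, so all sizes lie in \<open>{1..n - 1}\<close>. In
  each of the three cases two more sizes drop out: the top two, the bottom two, or one at each end.
  An interval of n - 3 numbers remains.\<close>

lemma card_sizes_le:
  assumes F: "\<F> \<subseteq> Pow {1..n}" and anti: "multiplicity_antichain r \<F>"
    and r: "2 \<le> r" and n: "4 \<le> n"
  shows "card (sizes \<F>) \<le> n - 3"
proof -
  have sub: "A \<subseteq> {1..n}" if "A \<in> \<F>" for A
    using F that by auto
  have fin: "finite A" if "A \<in> \<F>" for A
    using sub[OF that] finite_subset by blast
  have nincl: "A = B" if "A \<in> \<F>" "B \<in> \<F>" "A \<subseteq> B" for A B
    using anti that by (auto simp: multiplicity_antichain_def)
  have range: "1 \<le> s \<and> s \<le> n - 1" if s: "s \<in> sizes \<F>" for s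
  proof -
    obtain A B where AB: "A \<in> \<F>" "B \<in> \<F>" "A \<noteq> B" "card A = s" "card B = s"
      using two_in_layer[OF anti r s] .
    have "s \<noteq> 0"
      using AB fin by (metis card_0_eq)
    moreover have "card A < card {1..n}"
    proof (rule psubset_card_mono)
      show "A \<subset> {1..n}"
        using AB sub nincl by blast
    qed simp
    ultimately show ?thesis
      using AB by simp
  qed
  consider "1 \<in> sizes \<F>" | "n - 1 \<in> sizes \<F>" | "1 \<notin> sizes \<F>" "n - 1 \<notin> sizes \<F>"
    by blast
  then have "\<exists>l. sizes \<F> \<subseteq> {l..<l + (n - 3)}"
  proof cases
    case 1
    obtain A B where AB: "A \<in> \<F>" "B \<in> \<F>" "A \<noteq> B" "card A = 1" "card B = 1"
      using two_in_layer[OF anti r 1] .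
    then obtain a b where ab: "A = {a}" "B = {b}" "a \<noteq> b"
      by (metis card_1_singletonE)
    have "s < n - 2" if s: "s \<in> sizes \<F>" for s
    proof (rule ccontr)
      assume "\<not> s < n - 2"
      then have sn: "n - 2 \<le> s" by simp
      \<comment> \<open>A set of size at least n - 2 that avoids both singletons must be the full
        complement of \<open>{a, b}\<close>, so its layer cannot hold two sets.\<close>
      have *: "C = {1..n} - {a, b}" if C: "C \<in> \<F>" "card C = s" for C
      proof -
        have "C \<noteq> A" "C \<noteq> B"
          using AB C sn n by auto
        then have "a \<notin> C" "b \<notin> C"
          using nincl[of A C] nincl[of B C] AB C ab by auto
        then have "C \<subseteq> {1..n} - {a, b}"
          using sub C by auto
        moreover have "card ({1..n} - {a, b}) = n - 2"
          using ab AB sub[of A] sub[of B] by (subst card_Diff_subset) auto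
        ultimately show ?thesis
          using C sn by (intro card_seteq) auto
      qed
      show False
        using two_in_layer[OF anti r s] * by metis
    qed
    then have "sizes \<F> \<subseteq> {1..<1 + (n - 3)}"
      using range n by force
    then show ?thesis by blast
  next
    case 2
    obtain A B where AB: "A \<in> \<F>" "B \<in> \<F>" "A \<noteq> B" "card A = n - 1" "card B = n - 1"
      using two_in_layer[OF anti r 2] .
    have co: "\<exists>a. C = {1..n} - {a}" if C: "C \<in> \<F>" "card C = n - 1" for C
    proof -
      have "card ({1..n} - C) = 1"
        using C sub[of C] fin[of C] n by (subst card_Diff_subset) auto
      then obtain a where "{1..n} - C = {a}"
        by (metis card_1_singletonE)
      then show ?thesis
        using sub[of C] C by (metis double_diff subset_refl)
    qed
    obtain a b where ab: "A = {1..n} - {a}" "B = {1..n} - {b}" "a \<noteq> b"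
      using co AB by metis
    have "2 < s" if s: "s \<in> sizes \<F>" for s
    proof (rule ccontr)
      assume s2: "\<not> 2 < s"
      have *: "C = {a, b}" if C: "C \<in> \<F>" "card C = s" for C
      proof -
        have "C \<noteq> A" "C \<noteq> B"
          using AB C s2 n by auto
        then have "a \<in> C" "b \<in> C"
          using nincl[of C A] nincl[of C B] AB C ab sub[of C] by auto
        then show ?thesis
          using fin[of C] C s2 ab by (intro card_seteq[symmetric]) auto
      qed
      show False
        using two_in_layer[OF anti r s] * by metis
    qed
    then have "sizes \<F> \<subseteq> {3..<3 + (n - 3)}"
      using range n by force
    then show ?thesis by blast
  next
    case 3
    have "sizes \<F> \<subseteq> {2..<2 + (n - 3)}"
    proof
      fix s assume s: "s \<in> sizes \<F>"
      then have "s \<noteq> 1" "s \<noteq> n - 1"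
        using 3 by auto
      then show "s \<in> {2..<2 + (n - 3)}"
        using range[OF s] n unfolding atLeastLessThan_iff by linarith
    qed
    then show ?thesis by blast
  qed
  then show ?thesis
    by (metis card_atLeastLessThan card_mono diff_add_inverse finite_atLeastLessThan)
qed

section \<open>Layered families\<close>

text \<open>Only inclusions from a smaller into a larger size are forbidden explicitly: for finite
  sets the other inclusions between distinct sets are impossible by cardinality.\<close>

definition layered :: "'a set \<Rightarrow> nat set \<Rightarrow> nat \<Rightarrow> (nat \<Rightarrow> 'a set set) \<Rightarrow> bool" where
  "layered V I r L \<longleftrightarrow>
     (\<forall>i\<in>I. (\<forall>A\<in>L i. A \<subseteq> V \<and> card A = i) \<and> r \<le> card (L i)) \<and>
     (\<forall>i\<in>I. \<forall>j\<in>I. i < j \<longrightarrow> (\<forall>A\<in>L i. \<forall>B\<in>L j. \<not> A \<subseteq> B))"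

lemma g_eq_of_layered:
  assumes L: "layered {1..n} {2..n - 2} r L" and r: "2 \<le> r" and n: "4 \<le> n"
  shows "g n r = n - 3"
proof (rule antisym)
  show "g n r \<le> n - 3"
    using card_sizes_le[OF _ _ r n] by (rule g_le)
  define \<F> where "\<F> = (\<Union>i\<in>{2..n - 2}. L i)"
  have LD: "A \<subseteq> {1..n}" "card A = i" if "i \<in> {2..n - 2}" "A \<in> L i" for i A
    using L that unfolding layered_def by blast+
  have Lr: "r \<le> card (L i)" if "i \<in> {2..n - 2}" for i
    using L that unfolding layered_def by blast
  have layer: "layer \<F> i = L i" if "i \<in> {2..n - 2}" for i
    using that LD unfolding layer_def \<F>_def by blast
  have sizes: "sizes \<F> = {2..n - 2}"
  proof
    show "sizes \<F> \<subseteq> {2..n - 2}"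
      using LD unfolding sizes_def \<F>_def by blast
    show "{2..n - 2} \<subseteq> sizes \<F>"
    proof
      fix i assume i: "i \<in> {2..n - 2}"
      then have "L i \<noteq> {}"
        using Lr[OF i] r by auto
      then show "i \<in> sizes \<F>"
        using i LD[OF i] unfolding sizes_def \<F>_def by blast
    qed
  qed
  have "\<not> A \<subseteq> B" if AB: "A \<in> \<F>" "B \<in> \<F>" "A \<noteq> B" for A B
  proof
    assume sub: "A \<subseteq> B"
    obtain i j where ij: "i \<in> {2..n - 2}" "A \<in> L i" "j \<in> {2..n - 2}" "B \<in> L j"
      using AB unfolding \<F>_def by blast
    have "finite B"
      using LD(1)[OF ij(3,4)] finite_subset by blast
    then have "i < j"
      using psubset_card_mono[of B A] sub AB LD(2) ij by blast
    then show False
      using L ij sub unfolding layered_def by blast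
  qed
  then have "multiplicity_antichain r \<F>"
    unfolding multiplicity_antichain_def sizes using layer Lr by auto
  moreover have "\<F> \<subseteq> Pow {1..n}"
    using LD(1) unfolding \<F>_def by blast
  ultimately have "card (sizes \<F>) \<le> g n r"
    by (intro g_ge)
  then show "n - 3 \<le> g n r"
    using n by (simp add: sizes)
qed

text \<open>Sizes above the middle are filled with complements of the sets of the mirrored size.
  Every lower set contains \<open>v\<close> and every complement misses it; between two upper sets,
  complementation reverses both inclusion and size.\<close>

lemma layered_complement:
  assumes L: "layered V {2..card V div 2} r L" and V: "finite V"
    and v: "\<And>i A. i \<in> {2..card V div 2} \<Longrightarrow> A \<in> L i \<Longrightarrow> v \<in> A"
  shows "\<exists>L'. layered V {2..card V - 2} r L'"
proof -
  let ?n = "card V" and ?h = "card V div 2"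
  define L' where "L' i = (if i \<le> ?h then L i else (\<lambda>A. V - A) ` L (?n - i))" for i
  have LD: "A \<subseteq> V" "card A = i" if "i \<in> {2..?h}" "A \<in> L i" for i A
    using L that unfolding layered_def by blast+
  have Lr: "r \<le> card (L i)" if "i \<in> {2..?h}" for i
    using L that unfolding layered_def by blast
  have Ln: "\<not> A \<subseteq> B" if "i \<in> {2..?h}" "j \<in> {2..?h}" "i < j" "A \<in> L i" "B \<in> L j" for i j A B
    using L that unfolding layered_def by blast
  have range: "?n - i \<in> {2..?h}" if "i \<in> {2..?n - 2}" "\<not> i \<le> ?h" for i
    using that by auto
  have "(\<forall>A\<in>L' i. A \<subseteq> V \<and> card A = i) \<and> r \<le> card (L' i)" if i: "i \<in> {2..?n - 2}" for i
  proof (cases "i \<le> ?h")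
    case True
    then have h: "i \<in> {2..?h}" and L'i: "L' i = L i"
      using i by (simp_all add: L'_def)
    show ?thesis
      unfolding L'i using LD[OF h] Lr[OF h] by blast
  next
    case False
    note h = range[OF i False]
    have "i \<le> ?n"
      using i by auto
    then have "card (V - A) = i" if "A \<in> L (?n - i)" for A
      using LD[OF h that] V by (simp add: card_Diff_subset finite_subset[of A V])
    moreover have "inj_on (\<lambda>A. V - A) (L (?n - i))"
      using LD(1)[OF h] by (intro inj_onI) blast
    ultimately have "\<forall>A\<in>(\<lambda>A. V - A) ` L (?n - i). A \<subseteq> V \<and> card A = i"
        "r \<le> card ((\<lambda>A. V - A) ` L (?n - i))"
      using Lr[OF h] by (blast, simp add: card_image)
    then show ?thesis
      using False by (simp add: L'_def)
  qed
  moreover have "\<not> A \<subseteq> B"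
    if ij: "i \<in> {2..?n - 2}" "j \<in> {2..?n - 2}" "i < j" and AB: "A \<in> L' i" "B \<in> L' j" for i j A B
  proof (cases "j \<le> ?h")
    case True
    then show ?thesis
      using Ln[of i j A B] ij AB by (auto simp: L'_def)
  next
    case j: False
    then obtain B' where B': "B = V - B'" "B' \<in> L (?n - j)"
      using AB by (auto simp: L'_def)
    note hj = range[OF ij(2) j]
    show ?thesis
    proof (cases "i \<le> ?h")
      case True
      then have "v \<in> A" "v \<in> B'"
        using v[of i A] v[OF hj B'(2)] ij AB by (auto simp: L'_def)
      then show ?thesis
        using B' by blast
    next
      case i: False
      then obtain A' where A': "A = V - A'" "A' \<in> L (?n - i)"
        using AB by (auto simp: L'_def)
      have "\<not> B' \<subseteq> A'"
        using Ln[OF hj range[OF ij(1) i] _ B'(2) A'(2)] ij by auto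
      then show ?thesis
        using A' B' LD(1)[OF hj B'(2)] by blast
    qed
  qed
  ultimately have "layered V {2..?n - 2} r L'"
    unfolding layered_def by blast
  then show ?thesis by blast
qed

section \<open>Codes\<close>

text \<open>\<open>D j\<close> is the prescribed part of a set with j points besides the common one.
  The bound \<open>card (D j) < j\<close> leaves at least one point free to vary. Nonemptiness
  allows codes on disjoint sets to be concatenated and keeps the free part small.\<close>

definition code :: "'a set \<Rightarrow> nat \<Rightarrow> nat \<Rightarrow> (nat \<Rightarrow> 'a set) \<Rightarrow> bool" where
  "code P a b D \<longleftrightarrow>
     (\<forall>j\<in>{a..<b}. D j \<subseteq> P \<and> D j \<noteq> {} \<and> card (D j) < j) \<and>
     (\<forall>i\<in>{a..<b}. \<forall>j\<in>{a..<b}. i < j \<longrightarrow> \<not> D i \<subseteq> D j)"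

text \<open>A nonempty subset of \<open>P\<close> is never contained in a subset of the disjoint set
  \<open>Q\<close>, and only inclusions of an earlier code in a later one matter.\<close>

lemma code_append:
  assumes D: "code P a b D" and E: "code Q b c E" and disj: "P \<inter> Q = {}"
  shows "code (P \<union> Q) a c (\<lambda>j. if j < b then D j else E j)"
proof -
  have DD: "D j \<subseteq> P" "D j \<noteq> {}" "card (D j) < j" if "j \<in> {a..<b}" for j
    using D that unfolding code_def by blast+
  have EE: "E j \<subseteq> Q" "E j \<noteq> {}" "card (E j) < j" if "j \<in> {b..<c}" for j
    using E that unfolding code_def by blast+
  have DE: "\<not> D i \<subseteq> E j" if "i \<in> {a..<b}" "j \<in> {b..<c}" for i j
    using DD[OF that(1)] EE[OF that(2)] disj by blast
  have Dn: "\<not> D i \<subseteq> D j" if "i \<in> {a..<b}" "j \<in> {a..<b}" "i < j" for i j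
    using D that unfolding code_def by blast
  have En: "\<not> E i \<subseteq> E j" if "i \<in> {b..<c}" "j \<in> {b..<c}" "i < j" for i j
    using E that unfolding code_def by blast
  show ?thesis
    unfolding code_def
  proof (intro conjI ballI impI)
    fix j assume j: "j \<in> {a..<c}"
    show "(if j < b then D j else E j) \<subseteq> P \<union> Q" "(if j < b then D j else E j) \<noteq> {}"
      "card (if j < b then D j else E j) < j"
      using DD[of j] EE[of j] j by auto
  next
    fix i j assume "i \<in> {a..<c}" "j \<in> {a..<c}" "i < j"
    then show "\<not> (if i < b then D i else E i) \<subseteq> (if j < b then D j else E j)"
      using DE[of i j] Dn[of i j] En[of i j] by auto
  qed
qed

text \<open>This lists the subsets in an order extending reverse inclusion: first those that contain
  the new point \<open>x\<close>, in the inductive order, then those without it.\<close>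

lemma subsets_enumeration:
  fixes P :: "'a set"
  assumes "finite P"
  shows "\<exists>D :: nat \<Rightarrow> 'a set. (\<forall>i<2 ^ card P. D i \<subseteq> P) \<and> (\<forall>j<2 ^ card P. \<forall>i<j. \<not> D i \<subseteq> D j)"
  using assms
proof (induction P rule: finite_induct)
  case empty
  show ?case by (intro exI[of _ "\<lambda>_. {}"]) auto
next
  case (insert x P)
  let ?N = "2 ^ card P :: nat"
  obtain D where D: "\<And>i. i < ?N \<Longrightarrow> D i \<subseteq> P" "\<And>i j. j < ?N \<Longrightarrow> i < j \<Longrightarrow> \<not> D i \<subseteq> D j"
    using insert.IH by blast
  define E where "E i = (if i < ?N then insert x (D i) else D (i - ?N))" for i
  have N: "2 ^ card (insert x P) = 2 * ?N"
    using insert.hyps by simp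
  have "E i \<subseteq> insert x P" if "i < 2 * ?N" for i
  proof (cases "i < ?N")
    case True
    then show ?thesis
      using D(1)[of i] by (auto simp: E_def)
  next
    case False
    then have "i - ?N < ?N"
      using that by linarith
    then show ?thesis
      using D(1)[of "i - ?N"] False by (auto simp: E_def)
  qed
  moreover have "\<not> E i \<subseteq> E j" if "j < 2 * ?N" "i < j" for i j
  proof -
    have x: "x \<notin> D k" if "k < ?N" for k
      using D(1)[OF that] insert.hyps by blast
    consider "j < ?N" | "i < ?N" "?N \<le> j" | "?N \<le> i"
      by linarith
    then show ?thesis
    proof cases
      case 1
      then have "\<not> insert x (D i) \<subseteq> insert x (D j)"
        using D(2)[of j i] x[of i] \<open>i < j\<close> by auto
      then show ?thesis
        using 1 \<open>i < j\<close> by (simp add: E_def)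
    next
      case 2
      then show ?thesis
        using x[of "j - ?N"] \<open>j < 2 * ?N\<close> by (auto simp: E_def)
    next
      case 3
      then show ?thesis
        using D(2)[of "j - ?N" "i - ?N"] that by (simp add: E_def)
    qed
  qed
  ultimately show ?case
    unfolding N by blast
qed

text \<open>The last subset in the enumeration may be empty, so it is dropped, whence the - 1. An
  earlier empty set would be contained in its successor. Starting at an index above
  \<open>card P\<close> makes the size condition automatic.\<close>

lemma code_subsets:
  assumes P: "finite P" and a: "card P < a"
  shows "\<exists>D. code P a (a + 2 ^ card P - 1) D"
proof -
  obtain D where D: "\<And>i :: nat. i < 2 ^ card P \<Longrightarrow> D i \<subseteq> P"
      "\<And>i j. j < 2 ^ card P \<Longrightarrow> i < j \<Longrightarrow> \<not> D i \<subseteq> D j"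
    using subsets_enumeration[OF P] by blast
  have nonempty: "D i \<noteq> {}" if "i < 2 ^ card P - 1" for i
  proof -
    have "i + 1 < 2 ^ card P"
      using that by linarith
    then show ?thesis
      using D(2)[of "i + 1" i] by auto
  qed
  have card: "card (D i) \<le> card P" if "i < 2 ^ card P" for i
    using D(1)[OF that] P by (simp add: card_mono)
  have "code P a (a + 2 ^ card P - 1) (\<lambda>j. D (j - a))"
    unfolding code_def
  proof (intro conjI ballI impI)
    fix j assume "j \<in> {a..<a + 2 ^ card P - 1}"
    then have j: "a \<le> j" "j - a < 2 ^ card P - 1"
      by auto
    then have "j - a < 2 ^ card P"
      by linarith
    with j show "D (j - a) \<subseteq> P" "D (j - a) \<noteq> {}" "card (D (j - a)) < j"
      using D(1)[of "j - a"] nonempty card[of "j - a"] a by auto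
  next
    fix i j assume "i \<in> {a..<a + 2 ^ card P - 1}" "j \<in> {a..<a + 2 ^ card P - 1}" "i < j"
    then show "\<not> D (i - a) \<subseteq> D (j - a)"
      by (intro D(2)) auto
  qed
  then show ?thesis by blast
qed

text \<open>At index 2 the condition \<open>card (D j) < j\<close> admits only singletons. Using one
  singleton per point is a slow start that raises the index until richer codes are allowed.\<close>

lemma code_singletons:
  assumes "finite P"
  shows "\<exists>D. code P 2 (2 + card P) D"
  using assms
proof (induction P rule: finite_induct)
  case empty
  show ?case by (auto simp: code_def)
next
  case (insert x P)
  obtain D where D: "code P 2 (2 + card P) D"
    using insert.IH by blast
  obtain E where "code {x} (2 + card P) (3 + card P) E"
    using code_subsets[of "{x}" "2 + card P"] by (auto simp: eval_nat_numeral)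
  from code_append[OF D this] insert.hyps show ?case
    by (auto simp: eval_nat_numeral)
qed

text \<open>Three blocks on disjoint point sets bootstrap each other: u singletons raise the index
  to 2 + u, where all nonempty subsets of u points are small enough; these raise it by
  \<open>2 ^ u - 1\<close>, beyond t, where the nonempty subsets of t points are small
  enough.\<close>

lemma code_exists:
  assumes P: "finite P" "card P = t + 2 * u" and t: "t \<le> 2 ^ u"
  shows "\<exists>D. code P 2 (2 ^ t) D"
proof -
  obtain P1 where P1: "P1 \<subseteq> P" "card P1 = u" "finite P1"
    using obtain_subset_with_card_n[of u P] P by auto
  then have "card (P - P1) = t + u"
    using P by (simp add: card_Diff_subset)
  then obtain P2 where P2: "P2 \<subseteq> P - P1" "card P2 = u" "finite P2"
    using obtain_subset_with_card_n[of u "P - P1"] by auto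
  define P3 where "P3 = P - P1 - P2"
  have P3: "card P3 = t" "finite P3"
    using \<open>card (P - P1) = t + u\<close> P2 P by (simp_all add: P3_def card_Diff_subset)
  obtain D1 where D1: "code P1 2 (2 + u) D1"
    using code_singletons[OF P1(3)] P1 by auto
  obtain D2 where D2: "code P2 (2 + u) (2 + u + 2 ^ u - 1) D2"
    using code_subsets[OF P2(3), of "2 + u"] P2 by auto
  obtain D3 where D3: "code P3 (2 + u + 2 ^ u - 1) (2 + u + 2 ^ u - 1 + 2 ^ t - 1) D3"
    using code_subsets[OF P3(2), of "2 + u + 2 ^ u - 1"] P3 t by auto
  obtain D where D: "code ((P1 \<union> P2) \<union> P3) 2 (2 + u + 2 ^ u - 1 + 2 ^ t - 1) D"
    using code_append[OF code_append[OF D1 D2] D3] P2(1) by (force simp: P3_def)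
  have "(P1 \<union> P2) \<union> P3 = P"
    using P1 P2 by (auto simp: P3_def)
  moreover have "2 ^ t \<le> 2 + u + 2 ^ u - 1 + 2 ^ t - (1 :: nat)"
    by simp
  ultimately have "code P 2 (2 ^ t) D"
    using D unfolding code_def by auto
  then show ?thesis by blast
qed

section \<open>The lower bound\<close>

text \<open>Induction by Pascal's rule. It ensures that \<open>r\<close> points in \<open>Q\<close>
  already give \<open>r\<close> choices of the free part, whatever its size strictly between 0 and
  \<open>card Q\<close>.\<close>

lemma le_binomial:
  assumes "0 < k" "k < n"
  shows "n \<le> n choose k"
  using assms
proof (induction n arbitrary: k)
  case (Suc n)
  obtain l where l: "k = Suc l"
    using Suc.prems by (cases k) auto
  show ?case
  proof (cases "k = n")
    case True
    then show ?thesis by simp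
  next
    case False
    then have "n \<le> n choose k"
      using Suc by simp
    moreover have "1 \<le> n choose l"
      using Suc.prems l by (simp add: Suc_leI)
    ultimately show ?thesis
      by (simp add: l)
  qed
qed simp

text \<open>The point 1, the \<open>r\<close> leaves and the t + 2 * u code points leave at least
  \<open>r\<close> points for \<open>Q\<close>, and also at least n div 2 - 1, enough for the free
  parts of all sets in the lower half. \<open>n \<le> 2 ^ t\<close> provides a code for every index
  below n div 2.\<close>

lemma layered_exists:
  assumes n: "2 * r + 2 * (t + 2 * u) \<le> n" and nt: "n \<le> 2 ^ t" and tu: "t \<le> 2 ^ u"
    and r: "1 \<le> r"
  shows "\<exists>L. layered {1..n} {2..n - 2} r L"
proof -
  have t: "1 \<le> t"
    using n nt r by (cases t) auto
  have n1: "1 \<in> {1..n}"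
    using n r by simp
  have "r \<le> card ({1..n} - {1})"
    using n r t n1 by simp
  then obtain A where A: "A \<subseteq> {1..n} - {1}" "card A = r" "finite A"
    by (rule obtain_subset_with_card_n)
  have cA: "card ({1..n} - {1} - A) = n - 1 - r"
    using A n1 by (simp add: card_Diff_subset)
  have "t + 2 * u \<le> card ({1..n} - {1} - A)"
  proof -
    have "t + 2 * u + r + 1 \<le> n"
      using n r t by simp
    then show ?thesis
      unfolding cA by simp
  qed
  then obtain P where P: "P \<subseteq> {1..n} - {1} - A" "card P = t + 2 * u" "finite P"
    by (rule obtain_subset_with_card_n)
  define Q where "Q = {1..n} - {1} - A - P"
  have Q: "card Q = n - 1 - r - (t + 2 * u)" "finite Q"
    using cA P by (simp_all add: Q_def card_Diff_subset)
  have sub: "P \<subseteq> {1..n}" "Q \<subseteq> {1..n}" "A \<subseteq> {1..n}" "1 \<notin> P" "1 \<notin> Q" "1 \<notin> A"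
      "P \<inter> Q = {}" "A \<inter> P = {}" "A \<inter> Q = {}"
    using A P by (auto simp: Q_def)
  obtain D where D: "code P 2 (2 ^ t) D"
    using code_exists[OF P(3,2) tu] by blast
  define X where "X j = {X. X \<subseteq> Q \<and> card X = j - card (D j)}" for j
  \<comment> \<open>The common point takes one place, so size \<open>s\<close> uses the code with
    index s - 1. Codes begin at index 2, hence size 2 needs the separate star, with leaves outside
    \<open>P\<close> and \<open>Q\<close>.\<close>
  define L where "L s = (if s = 2 then (\<lambda>a. {1, a}) ` A
      else (\<lambda>X. insert 1 (D (s - 1) \<union> X)) ` X (s - 1))" for s
  have DD: "D j \<subseteq> P" "D j \<noteq> {}" "card (D j) < j" "finite (D j)"
    if "2 \<le> j" "j < n div 2" for j
  proof -
    have "j \<in> {2..<2 ^ t}"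
      using that nt by auto
    then show "D j \<subseteq> P" "D j \<noteq> {}" "card (D j) < j"
      using D unfolding code_def by blast+
    then show "finite (D j)"
      using P(3) finite_subset by blast
  qed
  have Dn: "\<not> D i \<subseteq> D j" if "2 \<le> i" "i < j" "j < n div 2" for i j
  proof -
    have "i \<in> {2..<2 ^ t}" "j \<in> {2..<2 ^ t}"
      using that nt by auto
    then show ?thesis
      using D that unfolding code_def by blast
  qed
  have Xr: "r \<le> card (X j)" if j: "2 \<le> j" "j < n div 2" for j
  proof -
    have "0 < card (D j)"
      using DD[OF j] by (simp add: card_gt_0_iff)
    \<comment> \<open>\<open>card Q\<close> may equal j when j = n div 2 - 1; the nonempty code
      makes the second inequality strict.\<close>
    then have "0 < j - card (D j)" "j - card (D j) < card Q"
      using DD(3)[OF j] Q(1) j n by auto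
    then have "card Q \<le> card (X j)"
      unfolding X_def n_subsets[OF Q(2)] by (intro le_binomial)
    moreover have "r \<le> card Q"
      using n t Q(1) by auto
    ultimately show ?thesis by simp
  qed
  have "layered {1..n} {2..n div 2} r L"
    unfolding layered_def
  proof (intro conjI ballI impI)
    fix s assume s: "s \<in> {2..n div 2}"
    show "r \<le> card (L s)"
    proof (cases "s = 2")
      case True
      have "inj_on (\<lambda>a. {1, a}) A"
        using sub by (intro inj_onI) (auto simp: doubleton_eq_iff)
      then show ?thesis
        using True A by (simp add: L_def card_image)
    next
      case False
      then have j: "2 \<le> s - 1" "s - 1 < n div 2"
        using s by auto
      have "inj_on (\<lambda>X. insert 1 (D (s - 1) \<union> X)) (X (s - 1))"
      proof (rule inj_onI)
        fix Y Z assume YZ: "Y \<in> X (s - 1)" "Z \<in> X (s - 1)"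
          and eq: "insert 1 (D (s - 1) \<union> Y) = insert 1 (D (s - 1) \<union> Z)"
        \<comment> \<open>Intersecting with \<open>Q\<close> recovers the free part, since 1 and the
          code lie outside \<open>Q\<close>.\<close>
        have "Y = insert 1 (D (s - 1) \<union> Y) \<inter> Q" "Z = insert 1 (D (s - 1) \<union> Z) \<inter> Q"
          using YZ DD(1)[OF j] sub by (auto simp: X_def)
        then show "Y = Z"
          using eq by simp
      qed
      then show ?thesis
        using False Xr[OF j] by (simp add: L_def card_image)
    qed
    fix B assume B: "B \<in> L s"
    have "B \<subseteq> {1..n} \<and> card B = s"
    proof (cases "s = 2")
      case True
      then obtain a where "a \<in> A" "B = {1, a}"
        using B by (auto simp: L_def)
      moreover from this have "1 \<noteq> a"
        using sub by blast
      ultimately show ?thesis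
        using True sub n1 by auto
    next
      case False
      then have j: "2 \<le> s - 1" "s - 1 < n div 2"
        using s by auto
      obtain Y where Y: "Y \<subseteq> Q" "card Y = s - 1 - card (D (s - 1))"
          "B = insert 1 (D (s - 1) \<union> Y)"
        using B False by (auto simp: L_def X_def)
      have "finite Y"
        using Y(1) Q(2) by (rule finite_subset)
      moreover have "D (s - 1) \<inter> Y = {}" "1 \<notin> D (s - 1) \<union> Y"
        using Y DD(1)[OF j] sub by auto
      ultimately have "card B = Suc (card (D (s - 1)) + card Y)"
        using DD(4)[OF j] Y(3) by (simp add: card_Un_disjoint)
      then show ?thesis
        using Y DD(1,3)[OF j] sub n1 j by auto
    qed
    then show "B \<subseteq> {1..n}" "card B = s" by auto
  next
    fix i j B C
    assume ij: "i \<in> {2..n div 2}" "j \<in> {2..n div 2}" "i < j" and BC: "B \<in> L i" "C \<in> L j"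
    have j: "2 \<le> j - 1" "j - 1 < n div 2"
      using ij by auto
    obtain Z where Z: "Z \<subseteq> Q" "C = insert 1 (D (j - 1) \<union> Z)"
      using BC ij by (auto simp: L_def X_def)
    show "\<not> B \<subseteq> C"
    proof (cases "i = 2")
      case True
      then obtain a where "a \<in> A" "B = {1, a}"
        using BC by (auto simp: L_def)
      then show ?thesis
        using Z DD(1)[OF j] sub by auto
    next
      case False
      then have i: "2 \<le> i - 1" "i - 1 < n div 2"
        using ij by auto
      have "i - 1 < j - 1"
        using ij i by linarith
      from Dn[OF i(1) this j(2)]
      obtain d where d: "d \<in> D (i - 1)" "d \<notin> D (j - 1)"
        by blast
      have "d \<in> B"
        using BC d False by (auto simp: L_def)
      moreover have "d \<notin> C"
        using d Z DD(1)[OF i] sub by auto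
      ultimately show ?thesis by blast
    qed
  qed
  moreover have "1 \<in> B" if "B \<in> L s" for s B
    using that by (cases "s = 2") (auto simp: L_def)
  ultimately have "\<exists>L'. layered {1..n} {2..card {1..n} - 2} r L'"
    by (intro layered_complement[where v = 1 and L = L]) simp_all
  then show ?thesis
    by simp
qed

section \<open>Two sets of each size, by induction on the ground set\<close>

text \<open>Adding n + 1 to the old sets shifts their sizes to 3, ..., n - 1. The new pairs contain
  n + 2, which the shifted sets lack; the shifted sets contain n + 1, which the new n-sets lack.
  Each new n-set also omits a point of each new pair, which is why 1 is left out of the one
  containing n + 2.\<close>

lemma layered_two_step:
  assumes L: "layered {1..n} {2..n - 2} 2 L" and n: "2 \<le> n"
  shows "\<exists>L'. layered {1..n + 2} {2..n} 2 L'"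
proof -
  define L' where "L' s =
      (if s = 2 then {{n + 2, 1}, {n + 1, n + 2}}
       else if s = n then {insert (n + 2) {2..n}, {1..n}}
       else insert (n + 1) ` L (s - 1))" for s
  have LD: "A \<subseteq> {1..n}" "card A = i" if "i \<in> {2..n - 2}" "A \<in> L i" for i A
    using L that unfolding layered_def by blast+
  have Lr: "2 \<le> card (L i)" if "i \<in> {2..n - 2}" for i
    using L that unfolding layered_def by blast
  have Ln: "\<not> A \<subseteq> B" if "i \<in> {2..n - 2}" "j \<in> {2..n - 2}" "i < j" "A \<in> L i" "B \<in> L j" for i j A B
    using L that unfolding layered_def by blast
  have mid: "s - 1 \<in> {2..n - 2}" if "s \<in> {2..n}" "s \<noteq> 2" "s \<noteq> n" for s
    using that by auto
  have new: "n + 1 \<notin> A" "n + 2 \<notin> A" if "i \<in> {2..n - 2}" "A \<in> L i" for i A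
    using LD(1)[OF that] by auto
  have "layered {1..n + 2} {2..n} 2 L'"
    unfolding layered_def
  proof (intro conjI ballI impI)
    fix s assume s: "s \<in> {2..n}"
    consider "s = 2" | "s = n" "s \<noteq> 2" | "s \<noteq> 2" "s \<noteq> n"
      by blast
    then have "2 \<le> card (L' s) \<and> (\<forall>A\<in>L' s. A \<subseteq> {1..n + 2} \<and> card A = s)"
    proof cases
      case 1
      then show ?thesis
        using n by (auto simp: L'_def doubleton_eq_iff)
    next
      case 2
      have "n + 2 \<notin> {1..n}"
        by simp
      then have "insert (n + 2) {2..n} \<noteq> {1..n}"
        by blast
      then show ?thesis
        using n 2 by (auto simp: L'_def)
    next
      case 3
      note m = mid[OF s 3]
      have "inj_on (insert (n + 1)) (L (s - 1))"
        using new(1)[OF m] by (intro inj_onI) (metis insert_ident)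
      moreover have "card (insert (n + 1) A) = s" if "A \<in> L (s - 1)" for A
        using LD[OF m that] new(1)[OF m that] s finite_subset[of A "{1..n}"] by simp
      moreover have "insert (n + 1) A \<subseteq> {1..n + 2}" if "A \<in> L (s - 1)" for A
        using LD(1)[OF m that] by auto
      ultimately show ?thesis
        using Lr[OF m] 3 by (auto simp: L'_def card_image)
    qed
    then show "2 \<le> card (L' s)" "\<And>A. A \<in> L' s \<Longrightarrow> A \<subseteq> {1..n + 2}" "\<And>A. A \<in> L' s \<Longrightarrow> card A = s"
      by auto
  next
    fix i j A B
    assume ij: "i \<in> {2..n}" "j \<in> {2..n}" "i < j" and AB: "A \<in> L' i" "B \<in> L' j"
    consider "i = 2" "j = n" | "i = 2" "j \<noteq> n" | "i \<noteq> 2" "j = n" | "i \<noteq> 2" "j \<noteq> n"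
      by blast
    then show "\<not> A \<subseteq> B"
    proof cases
      case 1
      then show ?thesis
        using AB ij by (auto simp: L'_def)
    next
      case 2
      then have "n + 2 \<in> A"
        using AB by (auto simp: L'_def)
      moreover have "n + 2 \<notin> B"
        using AB 2 ij new(2)[OF mid[of j]] by (auto simp: L'_def)
      ultimately show ?thesis by blast
    next
      case 3
      then have "n + 1 \<in> A" "n + 1 \<notin> B"
        using AB ij by (auto simp: L'_def)
      then show ?thesis by blast
    next
      case 4
      have m: "i - 1 \<in> {2..n - 2}" "j - 1 \<in> {2..n - 2}"
        using mid[of i] mid[of j] 4 ij by auto
      obtain A' B' where A': "A = insert (n + 1) A'" "A' \<in> L (i - 1)"
        and B': "B = insert (n + 1) B'" "B' \<in> L (j - 1)"
        using AB 4 ij by (auto simp: L'_def)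
      have "\<not> A' \<subseteq> B'"
        using Ln[OF m _ A'(2) B'(2)] ij by auto
      then show ?thesis
        using A' B' new(1)[OF m(1) A'(2)] by auto
    qed
  qed
  then show ?thesis by blast
qed

lemma layered_two:
  assumes "2 \<le> n"
  shows "\<exists>L. layered {1..n} {2..n - 2} 2 L"
  using assms
proof (induction n rule: less_induct)
  case (less n)
  show ?case
  proof (cases "n < 4")
    case True
    then have "{2..n - 2} = {}" by auto
    then show ?thesis by (auto simp: layered_def)
  next
    case False
    then have "2 \<le> n - 2" "n - 2 < n" "n - 2 + 2 = n"
      by linarith+
    then show ?thesis
      using less.IH[of "n - 2"] layered_two_step[of "n - 2"] by metis
  qed
qed

section \<open>The threshold\<close>

text \<open>A natural number exceeds \<open>x\<close> exactly when it exceeds the integer part of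
  \<open>x\<close>, so that integer part competes in the \<open>LEAST\<close>.\<close>

lemma n0_le:
  assumes "0 \<le> x" "\<And>n. x < real n \<Longrightarrow> int (g n r) = int n - 3"
  shows "real (n0 r) \<le> x"
proof -
  have "n0 r \<le> nat \<lfloor>x\<rfloor>"
    unfolding n0_def using assms by (intro Least_le) (auto intro!: assms(2) simp: floor_less_iff nat_less_iff)
  then show ?thesis
    using assms(1) by linarith
qed

section \<open>Logarithmic estimates and the choice of t and u\<close>

lemma sqrt_2_le: "sqrt 2 \<le> 3 / 2"
  by (rule real_le_lsqrt) (simp_all add: power2_eq_square)

lemma log2_ge:
  assumes "3 \<le> r"
  shows "3 / 2 \<le> log 2 (real r)"
proof -
  have "(2 :: real) powr (3 / 2) = 2 powr (1 + 1 / 2)"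
    by simp
  also have "\<dots> = 2 * sqrt 2"
    by (subst powr_add) (simp add: powr_half_sqrt)
  also have "\<dots> \<le> 3"
    using sqrt_2_le by simp
  finally have "2 powr (3 / 2) \<le> real r"
    using assms by linarith
  then show ?thesis
    using assms by (subst le_log_iff) auto
qed

text \<open>A positive lower bound lets a multiple of the iterated logarithm absorb additive
  constants. It fails at r = 2, where the iterated logarithm is 0.\<close>

lemma log2_log2_ge:
  assumes "3 \<le> r"
  shows "1 / 2 \<le> log 2 (log 2 (real r))"
proof -
  have "(2 :: real) powr (1 / 2) \<le> 3 / 2"
    using sqrt_2_le by (simp add: powr_half_sqrt)
  then have "2 powr (1 / 2) \<le> log 2 (real r)"
    using log2_ge[OF assms] by linarith
  moreover have "0 < log 2 (real r)"
    using log2_ge[OF assms] by linarith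
  ultimately show ?thesis
    by (subst le_log_iff) auto
qed

lemma ceiling_log2:
  assumes "1 \<le> m"
  obtains k where "m \<le> 2 ^ k" "real k \<le> log 2 (real m) + 1"
proof
  let ?k = "nat \<lceil>log 2 (real m)\<rceil>"
  have nn: "0 \<le> log 2 (real m)"
    using assms by simp
  then show "real ?k \<le> log 2 (real m) + 1"
    by linarith
  have "log 2 (real m) \<le> real ?k"
    by linarith
  then have "real m \<le> 2 powr real ?k"
    using assms by (subst (asm) log_le_iff) auto
  then have "real m \<le> real (2 ^ ?k)"
    by (simp add: powr_realpow)
  then show "m \<le> 2 ^ ?k"
    by (simp only: of_nat_le_iff)
qed

lemma linear_le_power2:
  "7 \<le> t \<Longrightarrow> 8 * (t :: nat) \<le> 2 ^ (t - 1)"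
proof (induction t rule: dec_induct)
  case (step t)
  then show ?case by (cases t) auto
qed simp

text \<open>Take t and u as log 2 n and log 2 t rounded up. If n is at most 16 * r, both are
  controlled by logarithms of \<open>r\<close>; otherwise n is so large that crude linear bounds
  suffice.\<close>

lemma codes_fit:
  assumes r: "3 \<le> r"
    and n: "2 * real r + 2 * log 2 (real r) + 200 * log 2 (log 2 (real r)) < real n"
  obtains t u where "2 * r + 2 * (t + 2 * u) \<le> n" "n \<le> 2 ^ t" "t \<le> 2 ^ u"
proof -
  define l where "l = log 2 (real r)"
  have l: "3 / 2 \<le> l" and ll: "1 / 2 \<le> log 2 l"
    using log2_ge[OF r] log2_log2_ge[OF r] by (simp_all add: l_def)
  \<comment> \<open>The constant 200 enters here: 200 * (1 / 2) = 100, and 100 exceeds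
    \<open>2 ^ 6\<close>, which forces t to be at least 7.\<close>
  have n100: "100 < n"
    using n r l ll by (simp flip: l_def)
  obtain t where t: "n \<le> 2 ^ t" "real t \<le> log 2 (real n) + 1"
    using ceiling_log2[of n] n100 by auto
  have t7: "7 \<le> t"
  proof (rule ccontr)
    assume "\<not> 7 \<le> t"
    then have "(2 :: nat) ^ t \<le> 2 ^ 6"
      by (intro power_increasing) auto
    then show False
      using t n100 by simp
  qed
  obtain u where u: "t \<le> 2 ^ u" "real u \<le> log 2 (real t) + 1"
    using ceiling_log2[of t] t7 by auto
  have "2 * real r + 2 * (real t + 2 * real u) \<le> real n"
  proof (cases "n \<le> 16 * r")
    case True
    have "log 2 (real n) \<le> log 2 (real (16 * r))"
      using True n100 by (subst log_le_cancel_iff) auto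
    also have "\<dots> = log 2 (2 ^ 4) + l"
      using r by (simp add: log_mult l_def)
    also have "\<dots> = 4 + l"
      by (subst log_nat_power) auto
    finally have tl: "real t \<le> l + 5"
      using t by simp
    have "log 2 (real t) \<le> log 2 (2 ^ 3 * l)"
      using tl l t7 by (subst log_le_cancel_iff) auto
    also have "\<dots> = log 2 (2 ^ 3) + log 2 l"
      using l by (subst log_mult) auto
    also have "\<dots> = 3 + log 2 l"
      by (subst log_nat_power) auto
    finally have "real u \<le> log 2 l + 4"
      using u by simp
    \<comment> \<open>The excess over 2 * r + 2 * l is at most 10 + 16 + 4 * log 2 l, hence at most
      56 * log 2 l because log 2 l is at least 1 / 2.\<close>
    then show ?thesis
      using tl n ll by (simp flip: l_def)
  next
    case False
    have "u \<le> t"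
    proof -
      have "log 2 (real t) \<le> log 2 (2 ^ (t - 1))"
        using linear_le_power2[OF t7] t7
        by (subst log_le_cancel_iff) (auto simp flip: of_nat_power simp: of_nat_le_iff)
      also have "\<dots> = real (t - 1)"
        by (subst log_nat_power) auto
      finally show ?thesis
        using u t7 by linarith
    qed
    moreover have "real (2 ^ (t - 1)) \<le> real n"
    proof -
      have "real (t - 1) \<le> log 2 (real n)"
        using t t7 by simp
      then show ?thesis
        using n100 by (subst (asm) le_log_iff) (auto simp: powr_realpow)
    qed
    then have "8 * t \<le> n"
      using linear_le_power2[OF t7] unfolding of_nat_le_iff by linarith
    \<comment> \<open>With these bounds the left side is at most n / 8 + 6 * (n / 8), which is below
      n.\<close>
    ultimately have "real u \<le> real t" "8 * real t \<le> real n" "16 * real r \<le> real n"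
      using False by linarith+
    then have "2 * real r + 2 * real t + 4 * real u \<le> real n"
      by linarith
    then show ?thesis by simp
  qed
  then have "real (2 * r + 2 * (t + 2 * u)) \<le> real n"
    by simp
  then have "2 * r + 2 * (t + 2 * u) \<le> n"
    by (simp only: of_nat_le_iff)
  then show ?thesis
    using that t u by blast
qed

theorem theorem1p5:
  shows "\<exists>C::real. C > 0 \<and>
    (\<forall>r::nat. r \<ge> 2 \<longrightarrow>
      real (n0 r) \<le> 2 * real r + 2 * log 2 (real r) + C * log 2 (log 2 (real r)))"
proof (intro exI[of _ 200] conjI allI impI)
  fix r :: nat assume r2: "2 \<le> r"
  show "real (n0 r) \<le> 2 * real r + 2 * log 2 (real r) + 200 * log 2 (log 2 (real r))"
  proof (cases "r = 2")
    case True
    \<comment> \<open>For r = 2 the error term vanishes, and 6 = 2 * 2 + 2 * log 2 2 is the entire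
      bound.\<close>
    have "int (g n r) = int n - 3" if "6 < real n" for n
    proof -
      have "2 \<le> n"
        using that by simp
      from layered_two[OF this] obtain L where "layered {1..n} {2..n - 2} 2 L" ..
      then have "g n r = n - 3"
        using g_eq_of_layered[of n r L] True that by simp
      then show ?thesis
        using that by simp
    qed
    then have "real (n0 r) \<le> 6"
      by (intro n0_le) auto
    then show ?thesis
      using True by simp
  next
    case False
    then have r: "3 \<le> r"
      using r2 by simp
    show ?thesis
    proof (rule n0_le)
      show "0 \<le> 2 * real r + 2 * log 2 (real r) + 200 * log 2 (log 2 (real r))"
        using log2_ge[OF r] log2_log2_ge[OF r] by simp
      fix n :: nat
      assume n: "2 * real r + 2 * log 2 (real r) + 200 * log 2 (log 2 (real r)) < real n"
      then have n4: "4 \<le> n"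
        using log2_ge[OF r] log2_log2_ge[OF r] r by linarith
      obtain t u where "2 * r + 2 * (t + 2 * u) \<le> n" "n \<le> 2 ^ t" "t \<le> 2 ^ u"
        using codes_fit[OF r n] .
      moreover have "1 \<le> r"
        using r by simp
      ultimately have "\<exists>L. layered {1..n} {2..n - 2} r L"
        by (rule layered_exists)
      then obtain L where "layered {1..n} {2..n - 2} r L" ..
      then have "g n r = n - 3"
        using r2 n4 by (rule g_eq_of_layered)
      then show "int (g n r) = int n - 3"
        using n4 by simp
    qed
  qed
qed simp

end
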